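(* Let $\lambda_0,\lambda_1>0$ and $\epsilon\ge0$. For $t\in\{0,1\}$ let $\bm{M}_t^\star$ be the optimal solution of $\min_{\bm{M}\succeq\bm{O}}P_{\lambda_t}(\bm{M})$, and let $\bm{M}_0$ be an approximate solution for $\lambda_0$ satisfying $\|\bm{M}_0^\star-\bm{M}_0\|_F\le\epsilon$. Then $$\left\|\bm{M}_1^\star-\frac{\lambda_0+\lambda_1}{2\lambda_1}\bm{M}_0\right\|_F^2\le\left(\frac{|\lambda_0-\lambda_1|}{2\lambda_1}\left\|\bm{M}_0\right\|_F+\frac{|\lambda_0-\lambda_1|+\lambda_0+\lambda_1}{2\lambda_1}\epsilon\right)^2.$$
   Context: Let $\bm{x}_1,\dots,\bm{x}_n\in\mathbb{R}^d$ have labels $y_1,\dots,y_n$ in a discrete set, and let $\mathcal{T}=\{(i,j,l)\in\{1,\dots,n\}^3\mid y_i=y_j,\ i\neq j,\ y_i\neq y_l\}$. For $(i,j,l)\in\mathcal{T}$ put $\bm{H}_{ijl}=(\bm{x}_i-\bm{x}_l)(\bm{x}_i-\bm{x}_l)^\top-(\bm{x}_i-\bm{x}_j)(\bm{x}_i-\bm{x}_j)^\top$. $\langle \bm{A},\bm{B}\rangle=\mathrm{tr}(\bm{A}^\top\bm{B})$, $\|\bm{A}\|_F^2=\langle\bm{A},\bm{A}\rangle$, and $\bm{M}\succeq\bm{O}$ means that $\bm{M}\in\mathbb{R}^{d\times d}$ is (symmetric) positive semi-definite. The loss $\ell:\mathbb{R}\to\mathbb{R}$ is either the hinge loss $\ell(x)=\max\{0,1-x\}$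 (parameter $\gamma=0$), or, for a parameter $\gamma>0$, the smoothed hinge loss: $\ell(x)=0$ for $x>1$, $\ell(x)=\frac{1}{2\gamma}(1-x)^2$ for $1-\gamma\le x\le1$, $\ell(x)=1-x-\frac{\gamma}{2}$ for $x<1-\gamma$. For $\lambda>0$ the primal objective is $P_\lambda(\bm{M})=\sum_{(i,j,l)\in\mathcal{T}}\ell(\langle\bm{M},\bm{H}_{ijl}\rangle)+\frac{\lambda}{2}\|\bm{M}\|_F^2$; data and loss are the same for $\lambda_0$ and $\lambda_1$. *)

theory Defs
  imports "HOL-Analysis.Analysis"
begin

definition frob_inner :: "real^'d^'d \<Rightarrow> real^'d^'d \<Rightarrow> real" where
  "frob_inner A B = trace (transpose A ** B)"

definition frob_norm :: "real^'d^'d \<Rightarrow> real" where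
  "frob_norm A = sqrt (frob_inner A A)"

lemma frob_inner_eq_inner: "frob_inner A B = A \<bullet> B"
proof -
  have "frob_inner A B = (\<Sum>i\<in>UNIV. \<Sum>k\<in>UNIV. A $ k $ i * B $ k $ i)"
    by (simp add: frob_inner_def trace_def matrix_matrix_mult_def transpose_def)
  also have "\<dots> = (\<Sum>k\<in>UNIV. \<Sum>i\<in>UNIV. A $ k $ i * B $ k $ i)"
    by (rule sum.swap)
  finally show ?thesis
    by (simp add: inner_vec_def)
qed

lemma frob_norm_eq_norm: "frob_norm A = norm A"
  by (simp add: frob_norm_def frob_inner_eq_inner norm_eq_sqrt_inner)

definition psd :: "real^'d^'d \<Rightarrow> bool" where
  "psd M \<longleftrightarrow> transpose M = M \<and> (\<forall>v. 0 \<le> v \<bullet> (M *v v))"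

(* The matrix v v^T; the annotations fix the shapes d x 1 and 1 x d, which rowvector and
   columnvector leave polymorphic. *)
definition outer_square :: "real^'d \<Rightarrow> real^'d^'d" where
  "outer_square v = (columnvector v :: real^1^'d) ** (rowvector v :: real^'d^1)"

lemma outer_square_nth: "outer_square v $ i $ j = v $ i * v $ j"
  by (simp add: outer_square_def matrix_matrix_mult_def columnvector_def rowvector_def)

definition triplets :: "nat \<Rightarrow> (nat \<Rightarrow> 'label) \<Rightarrow> (nat \<times> nat \<times> nat) set" where
  "triplets n y =
     {(i, j, l). i \<in> {1..n} \<and> j \<in> {1..n} \<and> l \<in> {1..n} \<and> y i = y j \<and> i \<noteq> j \<and> y i \<noteq> y l}"

definition triplet_matrix :: "(nat \<Rightarrow> real^'d) \<Rightarrow> nat \<Rightarrow> nat \<Rightarrow> nat \<Rightarrow> real^'d^'d" where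
  "triplet_matrix x i j l = outer_square (x i - x l) - outer_square (x i - x j)"

definition hinge :: "real \<Rightarrow> real" where
  "hinge u = max 0 (1 - u)"

definition smoothed_hinge :: "real \<Rightarrow> real \<Rightarrow> real" where
  "smoothed_hinge \<gamma> u =
     (if u > 1 then 0
      else if 1 - \<gamma> \<le> u then 1 / (2 * \<gamma>) * (1 - u)\<^sup>2
      else 1 - u - \<gamma> / 2)"

(* Intended for \<gamma> \<ge> 0; the parameter value 0 encodes the plain hinge loss. *)
definition loss :: "real \<Rightarrow> real \<Rightarrow> real" where
  "loss \<gamma> = (if \<gamma> = 0 then hinge else smoothed_hinge \<gamma>)"

definition primal ::
  "nat \<Rightarrow> (nat \<Rightarrow> real^'d) \<Rightarrow> (nat \<Rightarrow> 'label) \<Rightarrow> real \<Rightarrow> real \<Rightarrow> real^'d^'d \<Rightarrow> real" where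
  "primal n x y \<gamma> lam M =
     (\<Sum>(i, j, l)\<in>triplets n y. loss \<gamma> (frob_inner M (triplet_matrix x i j l)))
     + lam / 2 * (frob_norm M)\<^sup>2"

definition primal_optimal ::
  "nat \<Rightarrow> (nat \<Rightarrow> real^'d) \<Rightarrow> (nat \<Rightarrow> 'label) \<Rightarrow> real \<Rightarrow> real \<Rightarrow> real^'d^'d \<Rightarrow> bool" where
  "primal_optimal n x y \<gamma> lam M \<longleftrightarrow> is_arg_min (primal n x y \<gamma> lam) psd M"

end

theory Submission
  imports Defs
begin

text \<open>Comparing each optimum with points on the segment to the other one gives
  \<open>f X \<ge> f A - a\<langle>A, X - A\<rangle>\<close> for the minimiser \<open>A\<close> of \<open>f + (a/2)\<parallel>\<cdot>\<parallel>\<^sup>2\<close> over a convex set.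
  Adding the two inequalities for the minimisers \<open>A\<close>, \<open>B\<close> with parameters \<open>a\<close>, \<open>b\<close> cancels the
  convex loss \<open>f\<close>; completing the square places \<open>B\<close> in the ball with centre
  \<open>((a + b)/(2b)) A\<close> and radius \<open>(\<bar>a - b\<bar>/(2b)) \<parallel>A\<parallel>\<close>. The triangle inequality then replaces \<open>A\<close>
  by its approximation.\<close>

text \<open>Averaging the supporting line at an intermediate point \<open>w\<close> over the two
  endpoints gives back \<open>f w\<close>, because the slope terms cancel. For piecewise losses this
  avoids comparing three points that may lie on different pieces.\<close>

lemma convex_on_if_subgradients:
  fixes f :: "real \<Rightarrow> real"
  assumes "\<And>u. \<exists>s. \<forall>v. f u + s * (v - u) \<le> f v"
  shows "convex_on UNIV f"
proof (rule convex_onI)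
  fix t u v :: real
  assume t: "0 < t" "t < 1"
  define w where "w = (1 - t) * u + t * v"
  obtain s where s: "\<And>z. f w + s * (z - w) \<le> f z"
    using assms by blast
  have "f w = (1 - t) * (f w + s * (u - w)) + t * (f w + s * (v - w))"
    by (simp add: w_def algebra_simps)
  also have "\<dots> \<le> (1 - t) * f u + t * f v"
    using t s by (intro add_mono mult_left_mono) auto
  finally show "f ((1 - t) *\<^sub>R u + t *\<^sub>R v) \<le> (1 - t) * f u + t * f v"
    by (simp add: w_def)
qed auto

lemma convex_on_hinge: "convex_on UNIV hinge"
proof (rule convex_on_if_subgradients)
  fix u
  show "\<exists>s. \<forall>v. hinge u + s * (v - u) \<le> hinge v"
    \<comment> \<open>Each affine piece lies below the maximum of both, so the slope of a piece
      active at \<open>u\<close> works; at the kink \<open>u = 1\<close> the flat one is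
      taken.\<close>
    by (rule exI[of _ "if u < 1 then - 1 else 0"]) (auto simp: hinge_def)
qed

text \<open>The smoothed hinge loss is the maximum over \<open>s \<in> [0, 1]\<close> of the affine functions
  \<open>s (1 - v) - \<gamma> s\<^sup>2 / 2\<close>.\<close>

lemma smoothed_hinge_ge:
  assumes "\<gamma> > 0" "0 \<le> s" "s \<le> 1"
  shows "s * (1 - v) - \<gamma> / 2 * s\<^sup>2 \<le> smoothed_hinge \<gamma> v"
proof -
  consider "v > 1" | "v \<le> 1" "1 - \<gamma> \<le> v" | "v \<le> 1" "v < 1 - \<gamma>"
    by linarith
  then show ?thesis
  proof cases
    case 1
    then have "s * (1 - v) \<le> 0" "0 \<le> \<gamma> / 2 * s\<^sup>2"
      using assms by (auto simp: mult_nonneg_nonpos)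
    with 1 show ?thesis by (simp add: smoothed_hinge_def)
  next
    case 2
    \<comment> \<open>The left side is the gap to the maximum over all real \<open>s\<close>, hence
      a perfect square.\<close>
    have "1 / (2 * \<gamma>) * (1 - v)\<^sup>2 - (s * (1 - v) - \<gamma> / 2 * s\<^sup>2) = (1 - v - \<gamma> * s)\<^sup>2 / (2 * \<gamma>)"
      using assms by (simp add: field_simps power2_eq_square)
    also have "\<dots> \<ge> 0"
      using assms by simp
    finally show ?thesis using 2 by (simp add: smoothed_hinge_def)
  next
    case 3
    \<comment> \<open>This is the gap between the values at 1 and at \<open>s\<close>. Since
      \<open>v < 1 - \<gamma>\<close>, both terms on the right are nonnegative.\<close>
    have "1 - v - \<gamma> / 2 - (s * (1 - v) - \<gamma> / 2 * s\<^sup>2)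
        = (1 - s) * (1 - v - \<gamma>) + \<gamma> / 2 * (1 - s)\<^sup>2"
      by (simp add: field_simps power2_eq_square)
    also have "\<dots> \<ge> 0"
      using assms 3 by simp
    finally show ?thesis using 3 assms by (simp add: smoothed_hinge_def)
  qed
qed

lemma smoothed_hinge_attained:
  assumes "\<gamma> > 0"
  obtains s where "0 \<le> s" "s \<le> 1" "smoothed_hinge \<gamma> u = s * (1 - u) - \<gamma> / 2 * s\<^sup>2"
proof -
  consider "u > 1" | "u \<le> 1" "1 - \<gamma> \<le> u" | "u \<le> 1" "u < 1 - \<gamma>"
    by linarith
  then show thesis
  proof cases
    case 1
    then show thesis using that[of 0] by (simp add: smoothed_hinge_def)
  next
    case 2
    \<comment> \<open>The stationary point in \<open>s\<close> is \<open>(1 - u) / \<gamma>\<close>,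
      which lies in [0, 1] exactly on this branch; the other two branches clamp it to 0 or
      1.\<close>
    then have "smoothed_hinge \<gamma> u
        = (1 - u) / \<gamma> * (1 - u) - \<gamma> / 2 * ((1 - u) / \<gamma>)\<^sup>2"
      using assms by (simp add: smoothed_hinge_def field_simps power2_eq_square)
    then show thesis using that[of "(1 - u) / \<gamma>"] 2 assms by simp
  next
    case 3
    then show thesis using that[of 1] assms by (simp add: smoothed_hinge_def)
  qed
qed

lemma convex_on_smoothed_hinge:
  assumes "\<gamma> > 0"
  shows "convex_on UNIV (smoothed_hinge \<gamma>)"
proof (rule convex_on_if_subgradients)
  fix u
  obtain s where s: "0 \<le> s" "s \<le> 1" "smoothed_hinge \<gamma> u = s * (1 - u) - \<gamma> / 2 * s\<^sup>2"
    using smoothed_hinge_attained[OF assms] by blast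
  \<comment> \<open>The affine function attaining the maximum at \<open>u\<close> stays below the
    loss everywhere, so it is a supporting line with slope \<open>- s\<close>.\<close>
  have "smoothed_hinge \<gamma> u + - s * (v - u) \<le> smoothed_hinge \<gamma> v" for v
    using smoothed_hinge_ge[OF assms s(1,2), of v] s(3) by (simp add: algebra_simps)
  then show "\<exists>s. \<forall>v. smoothed_hinge \<gamma> u + s * (v - u) \<le> smoothed_hinge \<gamma> v"
    by blast
qed

lemma convex_on_loss: "\<gamma> \<ge> 0 \<Longrightarrow> convex_on UNIV (loss \<gamma>)"
  using convex_on_hinge convex_on_smoothed_hinge[of \<gamma>] by (simp add: loss_def)

lemma convex_on_loss_inner:
  fixes H :: "'a::real_inner"
  assumes "\<gamma> \<ge> 0"
  shows "convex_on UNIV (\<lambda>M. loss \<gamma> (M \<bullet> H))"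
proof (rule convex_onI)
  fix t :: real and M N :: 'a
  assume "0 < t" "t < 1"
  then show "loss \<gamma> (((1 - t) *\<^sub>R M + t *\<^sub>R N) \<bullet> H)
      \<le> (1 - t) * loss \<gamma> (M \<bullet> H) + t * loss \<gamma> (N \<bullet> H)"
    using convex_onD[OF convex_on_loss[OF assms], of t "M \<bullet> H" "N \<bullet> H"]
    by (simp add: inner_add_left)
qed auto

lemma convex_on_sum_fun:
  assumes "finite I" "\<And>i. i \<in> I \<Longrightarrow> convex_on S (f i)" "convex S"
  shows "convex_on S (\<lambda>x. \<Sum>i\<in>I. f i x)"
  using assms(1,2) by (induction I) (auto simp: convex_on_const assms(3) intro: convex_on_add)

lemma convex_psd: "convex {M. psd M}"
proof (rule convexI)
  fix M N :: "real^'d^'d" and u v :: real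
  assume MN: "M \<in> {M. psd M}" "N \<in> {M. psd M}" and uv: "0 \<le> u" "0 \<le> v" "u + v = 1"
  have "transpose (u *\<^sub>R M + v *\<^sub>R N) = u *\<^sub>R transpose M + v *\<^sub>R transpose N"
    by (simp add: transpose_def vec_eq_iff)
  moreover have "w \<bullet> ((u *\<^sub>R M + v *\<^sub>R N) *v w) = u * (w \<bullet> (M *v w)) + v * (w \<bullet> (N *v w))" for w
    by (simp add: matrix_vector_mult_add_rdistrib scaleR_matrix_vector_assoc[symmetric] inner_add_right)
  ultimately show "u *\<^sub>R M + v *\<^sub>R N \<in> {M. psd M}"
    using MN uv by (simp add: psd_def)
qed

text \<open>This is the first-order optimality condition in a form that asks for no gradient of
  \<open>f\<close>, as the hinge loss has a kink: only the quadratic term is differentiated, through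
  a one-sided limit along the segment from \<open>A\<close> to \<open>X\<close>.\<close>

lemma regularized_minimizer_subgradient:
  fixes f :: "'a::real_inner \<Rightarrow> real"
  assumes K: "convex K" and f: "convex_on K f"
    and A: "A \<in> K" and X: "X \<in> K"
    and min: "\<And>Z. Z \<in> K \<Longrightarrow> f A + a / 2 * (norm A)\<^sup>2 \<le> f Z + a / 2 * (norm Z)\<^sup>2"
  shows "f A \<le> f X + a * (A \<bullet> (X - A))"
proof -
  \<comment> \<open>Moving a fraction \<open>t\<close> towards \<open>X\<close> changes the
    objective by at most \<open>t * (c + t * q)\<close>; minimality makes this nonnegative, and
    letting \<open>t\<close> tend to 0 leaves \<open>0 \<le> c\<close>.\<close>
  define c where "c = f X - f A + a * (A \<bullet> (X - A))"
  define q where "q = a / 2 * (norm (X - A))\<^sup>2"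
  have pos: "0 \<le> c + t * q" if t: "0 < t" "t < 1" for t
  proof -
    define Z where "Z = (1 - t) *\<^sub>R A + t *\<^sub>R X"
    have "Z \<in> K"
      unfolding Z_def using K A X t by (intro convexD) auto
    have "f Z \<le> (1 - t) * f A + t * f X"
      unfolding Z_def using convex_onD[OF f, of t A X] t A X by simp
    moreover have "Z = A + t *\<^sub>R (X - A)"
      by (simp add: Z_def algebra_simps)
    then have "(norm Z)\<^sup>2 = (norm A)\<^sup>2 + 2 * t * (A \<bullet> (X - A)) + t\<^sup>2 * (norm (X - A))\<^sup>2"
      by (simp only: power2_norm_eq_inner inner_add_left inner_add_right inner_scaleR_left
          inner_scaleR_right inner_commute[of "X - A" A]) (simp add: power2_eq_square distrib_left)
    ultimately have "f A + a / 2 * (norm A)\<^sup>2 \<le> (1 - t) * f A + t * f X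
        + a / 2 * ((norm A)\<^sup>2 + 2 * t * (A \<bullet> (X - A)) + t\<^sup>2 * (norm (X - A))\<^sup>2)"
      using min[OF \<open>Z \<in> K\<close>] by simp
    then have "0 \<le> t * (c + t * q)"
      by (simp add: c_def q_def algebra_simps power2_eq_square)
    then show ?thesis
      using t by (simp add: zero_le_mult_iff)
  qed
  have "((\<lambda>t. c + t * q) \<longlongrightarrow> c + 0 * q) (at_right 0)"
    by (intro tendsto_intros)
  moreover have "\<forall>\<^sub>F t in at_right 0. 0 \<le> c + t * q"
    using eventually_at_right_real[of 0 "1::real"] by (auto elim!: eventually_mono intro: pos)
  ultimately have "0 \<le> c + 0 * q"
    by (intro tendsto_lowerbound) auto
  then show ?thesis by (simp add: c_def)
qed

lemma regularized_minimizers_ball: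
  fixes f :: "'a::real_inner \<Rightarrow> real"
  assumes K: "convex K" and f: "convex_on K f"
    and A: "A \<in> K" "\<And>Z. Z \<in> K \<Longrightarrow> f A + a / 2 * (norm A)\<^sup>2 \<le> f Z + a / 2 * (norm Z)\<^sup>2"
    and B: "B \<in> K" "\<And>Z. Z \<in> K \<Longrightarrow> f B + b / 2 * (norm B)\<^sup>2 \<le> f Z + b / 2 * (norm Z)\<^sup>2"
    and b: "b > 0"
  shows "norm (B - ((a + b) / (2 * b)) *\<^sub>R A) \<le> \<bar>a - b\<bar> / (2 * b) * norm A"
proof -
  define k where "k = (a + b) / (2 * b)"
  have "0 \<le> a * (A \<bullet> (B - A)) + b * (B \<bullet> (A - B))"
    using regularized_minimizer_subgradient[OF K f A(1) B(1) A(2)]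
      regularized_minimizer_subgradient[OF K f B(1) A(1) B(2)] by simp
  then have "b * (B \<bullet> B) - (a + b) * (A \<bullet> B) + a * (A \<bullet> A) \<le> 0"
    by (simp add: inner_diff_right inner_commute[of B A] algebra_simps)
  then have "(b * (B \<bullet> B) - (a + b) * (A \<bullet> B) + a * (A \<bullet> A)) / b \<le> 0"
    using b by (simp add: divide_nonpos_pos)
  moreover have "2 * k = (a + b) / b"
    using b by (simp add: k_def field_simps)
  ultimately have "B \<bullet> B - 2 * k * (A \<bullet> B) + a / b * (A \<bullet> A) \<le> 0"
    using b by (simp add: diff_divide_distrib add_divide_distrib[of "_ - _"])
  moreover have "(norm (B - k *\<^sub>R A))\<^sup>2 = B \<bullet> B - 2 * k * (A \<bullet> B) + k\<^sup>2 * (A \<bullet> A)"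
    unfolding power2_norm_eq_inner
    by (simp add: inner_diff_left inner_diff_right inner_commute[of B A] power2_eq_square
        algebra_simps)
  ultimately have "(norm (B - k *\<^sub>R A))\<^sup>2 \<le> (k\<^sup>2 - a / b) * (A \<bullet> A)"
    by (simp add: left_diff_distrib)
  \<comment> \<open>Here (a + b)^2 - 4ab = (a - b)^2, over the common denominator 4b^2.\<close>
  also have "k\<^sup>2 - a / b = (\<bar>a - b\<bar> / (2 * b))\<^sup>2"
    using b by (simp add: k_def power_divide field_simps power2_eq_square)
  finally have "(norm (B - k *\<^sub>R A))\<^sup>2 \<le> (\<bar>a - b\<bar> / (2 * b) * norm A)\<^sup>2"
    by (simp only: power2_norm_eq_inner[symmetric] power_mult_distrib)
  then show ?thesis
    unfolding k_def using b by (rule_tac power2_le_imp_le) auto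
qed

lemma primal_optimalD:
  assumes "primal_optimal n x y \<gamma> lam M"
  shows "psd M" "psd Z \<Longrightarrow> primal n x y \<gamma> lam M \<le> primal n x y \<gamma> lam Z"
  using assms by (auto simp: primal_optimal_def is_arg_min_linorder)

theorem theorem3p10:
  fixes n :: nat
    and x :: "nat \<Rightarrow> real^'d"
    and y :: "nat \<Rightarrow> 'label"
    and \<gamma> lam0 lam1 \<epsilon> :: real
    and M0_star M1_star M0 :: "real^'d^'d"
  assumes "\<gamma> \<ge> 0"
    and "lam0 > 0" and "lam1 > 0" and "\<epsilon> \<ge> 0"
    and "primal_optimal n x y \<gamma> lam0 M0_star"
    and "primal_optimal n x y \<gamma> lam1 M1_star"
    and "frob_norm (M0_star - M0) \<le> \<epsilon>"
  shows "(frob_norm (M1_star - ((lam0 + lam1) / (2 * lam1)) *\<^sub>R M0))\<^sup>2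
    \<le> (\<bar>lam0 - lam1\<bar> / (2 * lam1) * frob_norm M0
        + (\<bar>lam0 - lam1\<bar> + lam0 + lam1) / (2 * lam1) * \<epsilon>)\<^sup>2"
proof -
  define f where
    "f M = (\<Sum>(i, j, l)\<in>triplets n y. loss \<gamma> (M \<bullet> triplet_matrix x i j l))" for M
  have primal: "primal n x y \<gamma> lam M = f M + lam / 2 * (norm M)\<^sup>2" for lam M
    by (simp add: primal_def f_def frob_inner_eq_inner frob_norm_eq_norm)
  have "triplets n y \<subseteq> {1..n} \<times> {1..n} \<times> {1..n}"
    by (auto simp: triplets_def)
  then have fin: "finite (triplets n y)"
    by (rule finite_subset) auto
  have "convex_on UNIV f"
    unfolding f_def case_prod_unfold
    using fin by (intro convex_on_sum_fun convex_on_loss_inner \<open>\<gamma> \<ge> 0\<close>) auto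
  then have "convex_on {M. psd M} f"
    using convex_psd by (auto intro: convex_on_subset)
  from regularized_minimizers_ball[OF convex_psd this, of M0_star lam0 M1_star lam1]
  have ball: "norm (M1_star - ((lam0 + lam1) / (2 * lam1)) *\<^sub>R M0_star)
      \<le> \<bar>lam0 - lam1\<bar> / (2 * lam1) * norm M0_star"
    using primal_optimalD[OF assms(5)] primal_optimalD[OF assms(6)] \<open>lam1 > 0\<close>
    by (simp add: primal)
  define k where "k = (lam0 + lam1) / (2 * lam1)"
  define r where "r = \<bar>lam0 - lam1\<bar> / (2 * lam1)"
  have k: "k \<ge> 0" and r: "r \<ge> 0"
    using assms(2,3) by (simp_all add: k_def r_def)
  have \<epsilon>: "norm (M0_star - M0) \<le> \<epsilon>"
    using assms(7) by (simp add: frob_norm_eq_norm)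
  have M0: "norm M0_star \<le> norm M0 + \<epsilon>"
    using norm_triangle_sub[of M0_star M0] \<epsilon> by linarith
  \<comment> \<open>The error \<epsilon> enters twice: moving the centre costs
    \<open>k * \<epsilon>\<close>, and bounding \<open>norm M0_star\<close> in the radius costs
    \<open>r * \<epsilon>\<close>. The coefficient of \<epsilon> in the claim is
    \<open>r + k\<close>.\<close>
  have "norm (M1_star - k *\<^sub>R M0) = norm ((M1_star - k *\<^sub>R M0_star) + k *\<^sub>R (M0_star - M0))"
    by (simp add: algebra_simps)
  also have "\<dots> \<le> norm (M1_star - k *\<^sub>R M0_star) + norm (k *\<^sub>R (M0_star - M0))"
    by (rule norm_triangle_ineq)
  also have "\<dots> \<le> r * (norm M0 + \<epsilon>) + k * \<epsilon>"
    using ball[folded k_def r_def] mult_left_mono[OF M0 r] mult_left_mono[OF \<epsilon> k] k by simp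
  also have "\<dots> = r * norm M0 + (\<bar>lam0 - lam1\<bar> + lam0 + lam1) / (2 * lam1) * \<epsilon>"
    by (simp add: k_def r_def add_divide_distrib algebra_simps)
  finally show ?thesis
    unfolding frob_norm_eq_norm k_def r_def by (rule power_mono) simp
qed

end
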